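(* Let $n$ be a positive integer and $0 \le k \le n-1$. Let $\mathcal{N}(n,k)$ be the set of all permutations of $[n]=\{1,\dots,n\}$ that have exactly $k$ ascents and are not parity alternating. Then the number of even permutations in $\mathcal{N}(n,k)$ equals the number of odd permutations in $\mathcal{N}(n,k)$.
   Context: A permutation $a_1a_2\cdots a_n$ of $[n]$ (in one-line notation) is parity alternating if its entries are alternately even and odd, i.e. $a_i$ and $a_{i+1}$ have different parities for every $1\le i\le n-1$. An ascent of $a_1\cdots a_n$ is an index $i$ ($1\le i\le n-1$) with $a_i<a_{i+1}$. An inversion is a pair $(i,j)$ with $1\le i<j\le n$ and $a_i>a_j$; a permutation is even or odd according to whether its number of inversions is even or odd. *)

theory Defs
  imports Main "HOL-Combinatorics.Permutations"
begin

text \<open>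
  A permutation of \<open>[n]\<close> is a function \<open>p :: nat \<Rightarrow> nat\<close> with \<open>p permutes {1..n}\<close>;
  its one-line notation is \<open>p 1, p 2, \<dots>, p n\<close>.
\<close>

definition parity_alternating :: "nat \<Rightarrow> (nat \<Rightarrow> nat) \<Rightarrow> bool" where
  "parity_alternating n p \<longleftrightarrow> (\<forall>i\<in>{1..<n}. even (p i) \<noteq> even (p (i + 1)))"

definition ascents :: "nat \<Rightarrow> (nat \<Rightarrow> nat) \<Rightarrow> nat set" where
  "ascents n p = {i \<in> {1..<n}. p i < p (i + 1)}"

definition inversions :: "nat \<Rightarrow> (nat \<Rightarrow> nat) \<Rightarrow> (nat \<times> nat) set" where
  "inversions n p = {(i, j). 1 \<le> i \<and> i < j \<and> j \<le> n \<and> p i > p j}"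

text \<open>
  Parity is defined by counting inversions, rather than by the library's \<open>evenperm\<close>,
  which is based on decompositions into transpositions.
\<close>

definition even_permutation :: "nat \<Rightarrow> (nat \<Rightarrow> nat) \<Rightarrow> bool" where
  "even_permutation n p \<longleftrightarrow> even (card (inversions n p))"

definition odd_permutation :: "nat \<Rightarrow> (nat \<Rightarrow> nat) \<Rightarrow> bool" where
  "odd_permutation n p \<longleftrightarrow> odd (card (inversions n p))"

definition non_parity_alternating_perms :: "nat \<Rightarrow> nat \<Rightarrow> (nat \<Rightarrow> nat) set" where
  "non_parity_alternating_perms n k =
     {p. p permutes {1..n} \<and> card (ascents n p) = k \<and> \<not> parity_alternating n p}"

end

theory Submission
  imports Defs "HOL-Library.Function_Algebras"
begin

text \<open>
  The cancellation already holds for every prescribed set \<open>S\<close> of forced ascents; inclusion-exclusion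
  then refines it to each exact ascent set. Forcing the ascents in \<open>S\<close> cuts \<open>[n]\<close> into runs of
  consecutive positions, and reading the inverse of a permutation lists the positions so that each
  run appears in increasing order. Building such a list letter by letter means repeatedly deleting
  the least remaining position of some run \<open>j\<close>; weighted by the sign, these deletions are linear
  operators \<open>\<theta>\<^sub>j\<close> that anticommute for different runs, so \<open>Q = \<Sum>\<^sub>j \<theta>\<^sub>j\<^sup>2\<close> is central and
  \<open>(\<Sum>\<^sub>j \<theta>\<^sub>j)\<^sup>2 = Q\<close>.

  A parity alternating list may use next only the runs in some set \<open>A\<close>, those whose least position
  has the required parity. After deleting from run \<open>j\<close> the required parity flips, and so does the
  parity of the least position of run \<open>j\<close> but of no other run: the new set is
  \<open>{j} \<union> (J - A)\<close>. Writing \<open>P\<^sub>n(A)\<close> for the signed count, anticommutation gives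
  \<open>P\<^sub>3(A) = Q P\<^sub>1(A)\<close>, hence \<open>P\<^sub>n\<^sub>+\<^sub>2(A) = Q P\<^sub>n(A)\<close> for \<open>n \<ge> 1\<close>, and
  \<open>P\<^sub>n(A) + P\<^sub>n(J - A)\<close> satisfies the same recursion and initial values as the signed count of all
  lists. The two terms are the alternating lists starting with either parity, so the remaining,
  non-alternating, ones cancel.
\<close>

section \<open>Algebra of anticommuting operators\<close>

text \<open>No relation is imposed on the square of a single \<open>\<theta> j\<close>: a run may be
  used repeatedly, and these squares make up \<open>quad\<close>. The vector \<open>e\<close> will
  be the indicator of the empty set of positions.\<close>

locale anticommuting =
  fixes J :: "'b set" and \<theta> :: "'b \<Rightarrow> 'v::ab_group_add \<Rightarrow> 'v" and e :: 'v
  assumes finite_J: "finite J"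
    and theta_add: "\<And>j x y. \<theta> j (x + y) = \<theta> j x + \<theta> j y"
    and theta_anticomm: "\<And>i j x. i \<noteq> j \<Longrightarrow> \<theta> i (\<theta> j x) = - \<theta> j (\<theta> i x)"
begin

definition lin :: "'b set \<Rightarrow> 'v \<Rightarrow> 'v" where
  "lin A x = (\<Sum>j\<in>A. \<theta> j x)"

definition quad :: "'b set \<Rightarrow> 'v \<Rightarrow> 'v" where
  "quad A x = (\<Sum>j\<in>A. \<theta> j (\<theta> j x))"

primrec total :: "nat \<Rightarrow> 'v" where
  "total 0 = e"
| "total (Suc n) = lin J (total n)"

text \<open>The outermost operator carries the first letter of a list, since an operator on
  functions of a set evaluates its argument at the set left after the deletion. \<open>A\<close>
  holds the runs admissible for that letter.\<close>

primrec alternating :: "nat \<Rightarrow> 'b set \<Rightarrow> 'v" where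
  "alternating 0 A = e"
| "alternating (Suc n) A = (\<Sum>j\<in>A. \<theta> j (alternating n (insert j (J - A))))"

lemma theta_zero: "\<theta> j 0 = 0"
  using theta_add[of j 0 0] by simp

lemma theta_minus: "\<theta> j (- x) = - \<theta> j x"
  using theta_add[of j x "- x"] theta_zero by (simp add: eq_neg_iff_add_eq_0 add.commute)

lemma theta_diff: "\<theta> j (x - y) = \<theta> j x - \<theta> j y"
  using theta_add[of j x "- y"] theta_minus by simp

lemma theta_sum: "\<theta> j (sum f A) = (\<Sum>i\<in>A. \<theta> j (f i))"
  by (induction A rule: infinite_finite_induct) (auto simp: theta_zero theta_add)

lemma lin_add: "lin A (x + y) = lin A x + lin A y"
  by (simp add: lin_def theta_add sum.distrib)

lemma lin_diff: "lin A (x - y) = lin A x - lin A y"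
  by (simp add: lin_def theta_diff sum_subtractf)

lemma quad_add: "quad A (x + y) = quad A x + quad A y"
  by (simp add: quad_def theta_add sum.distrib)

lemma quad_sum: "quad A (sum f B) = (\<Sum>i\<in>B. quad A (f i))"
  unfolding quad_def theta_sum by (rule sum.swap)

lemma lin_theta: "j \<notin> A \<Longrightarrow> lin A (\<theta> j x) = - \<theta> j (lin A x)"
  unfolding lin_def theta_sum sum_negf[symmetric]
  by (rule sum.cong) (auto intro: theta_anticomm)

text \<open>Moving \<open>\<theta> j\<close> past \<open>\<theta> i\<close> twice changes the sign
  twice, so squares commute with every operator.\<close>

lemma quad_theta: "quad A (\<theta> j x) = \<theta> j (quad A x)"
  unfolding quad_def theta_sum
proof (rule sum.cong)
  fix i show "\<theta> i (\<theta> i (\<theta> j x)) = \<theta> j (\<theta> i (\<theta> i x))"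
    by (cases "i = j") (simp_all add: theta_anticomm[of i j] theta_minus)
qed simp

lemma quad_lin: "quad A (lin B x) = lin B (quad A x)"
  by (simp add: lin_def quad_sum quad_theta)

lemma lin_lin_disjoint: "A \<inter> B = {} \<Longrightarrow> lin A (lin B x) = - lin B (lin A x)"
  unfolding lin_def[of B] using lin_theta[of _ A]
  by (subst lin_def) (auto simp: theta_sum lin_def sum_negf[symmetric] sum.swap[of _ A B]
      intro!: sum.cong theta_anticomm)

text \<open>The mixed terms cancel in pairs by anticommutation; only the squares survive.\<close>

lemma lin_lin: "finite A \<Longrightarrow> lin A (lin A x) = quad A x"
proof (induction A rule: finite_induct)
  case (insert a A)
  have "lin (insert a A) y = \<theta> a y + lin A y" for y
    using insert by (simp add: lin_def)
  moreover have "quad (insert a A) y = \<theta> a (\<theta> a y) + quad A y" for y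
    using insert by (simp add: quad_def)
  ultimately show ?case
    using insert by (simp add: theta_add lin_add lin_theta)
qed (simp add: lin_def quad_def)

lemma lin_Un: "finite A \<Longrightarrow> finite B \<Longrightarrow> A \<inter> B = {} \<Longrightarrow> lin (A \<union> B) x = lin A x + lin B x"
  by (simp add: lin_def sum.union_disjoint)

lemma quad_Un: "finite A \<Longrightarrow> finite B \<Longrightarrow> A \<inter> B = {} \<Longrightarrow> quad (A \<union> B) x = quad A x + quad B x"
  by (simp add: quad_def sum.union_disjoint)

lemma alternating_1: "alternating 1 A = lin A e"
  by (simp add: lin_def)

lemma alternating_2:
  assumes "A \<subseteq> J"
  shows "alternating 2 A = quad A e + lin A (lin (J - A) e)"
proof -
  have "lin (insert j (J - A)) e = \<theta> j e + lin (J - A) e" if "j \<in> A" for j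
    using that finite_J by (simp add: lin_def)
  then show ?thesis
    by (simp add: numeral_2_eq_2 lin_def[symmetric] theta_add sum.distrib quad_def)
qed

text \<open>Write a, b for \<open>lin A\<close>, \<open>lin (J - A)\<close> and Q, R for
  \<open>quad A\<close>, \<open>quad (J - A)\<close>. The three-step count is a R + a b a + Q (a +
  b) applied to \<open>e\<close>. Since a b a = - b a a = - Q b, what remains is (Q + R) a.\<close>

lemma alternating_3:
  assumes "A \<subseteq> J"
  shows "alternating 3 A = quad J (alternating 1 A)"
proof -
  define B where "B = J - A"
  have fin: "finite A" "finite B" and AB: "A \<inter> B = {}" "A \<union> B = J"
    using assms finite_J finite_subset by (auto simp: B_def)
  \<comment> \<open>Moving \<open>j\<close> from \<open>A\<close> over to \<open>B\<close> yields
    the square \<open>\<theta> j (\<theta> j e)\<close> once with each sign, so it cancels, and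
    passing \<open>\<theta> j\<close> through \<open>lin B\<close> turns the correction
    \<open>- \<theta> j e\<close> into \<open>+ \<theta> j (lin B e)\<close>.\<close>
  have step: "alternating 2 (insert j B)
      = quad B e + lin B (lin A e) + \<theta> j (lin A e + lin B e)" if "j \<in> A" for j
  proof -
    have j: "j \<notin> B" using that AB by auto
    have J: "J - insert j B = A - {j}" using AB that by auto
    have "insert j B \<subseteq> J" using AB that by auto
    then have "alternating 2 (insert j B) = quad (insert j B) e + lin (insert j B) (lin (A - {j}) e)"
      using alternating_2 J by metis
    also have "lin (A - {j}) e = lin A e - \<theta> j e"
      using that fin by (simp add: lin_def sum_diff1)
    also have "quad (insert j B) e = \<theta> j (\<theta> j e) + quad B e"
      using j fin by (simp add: quad_def)
    also have "lin (insert j B) (lin A e - \<theta> j e)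
        = \<theta> j (lin A e - \<theta> j e) + lin B (lin A e - \<theta> j e)"
      using j fin by (simp add: lin_def)
    also have "lin B (lin A e - \<theta> j e) = lin B (lin A e) + \<theta> j (lin B e)"
      using j by (simp add: lin_diff lin_theta)
    finally show ?thesis by (simp add: theta_add theta_diff algebra_simps)
  qed
  have "alternating 3 A = (\<Sum>j\<in>A. \<theta> j (alternating 2 (insert j B)))"
    by (simp add: numeral_3_eq_3 numeral_2_eq_2 B_def)
  also have "\<dots> = (\<Sum>j\<in>A. \<theta> j (quad B e + lin B (lin A e) + \<theta> j (lin A e + lin B e)))"
    using step by simp
  also have "\<dots> = lin A (quad B e + lin B (lin A e)) + quad A (lin A e + lin B e)"
    by (simp add: theta_add sum.distrib lin_def quad_def)
  also have "\<dots> = lin A (quad B e) + quad A (lin A e) + (lin A (lin B (lin A e)) + quad A (lin B e))"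
    by (simp add: lin_add quad_add algebra_simps)
  also have "lin A (lin B (lin A e)) + quad A (lin B e) = 0"
    using AB fin by (simp add: lin_lin_disjoint[of A B] lin_lin quad_lin)
  also have "lin A (quad B e) + quad A (lin A e) + 0 = quad J (lin A e)"
    using quad_Un[OF fin AB(1)] AB(2) by (simp add: quad_lin lin_add add.commute)
  finally show ?thesis by (simp add: alternating_1[simplified] )
qed

text \<open>The recursion adds operators on the outside, where \<open>quad J\<close> commutes with
  them, so the case of three steps propagates. It fails to start at 0: two steps give
  \<open>quad A e\<close> plus mixed terms, in general not \<open>quad J e\<close>.\<close>

lemma alternating_add2:
  "A \<subseteq> J \<Longrightarrow> n > 0 \<Longrightarrow> alternating (n + 2) A = quad J (alternating n A)"
proof (induction n arbitrary: A)
  case (Suc n)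
  show ?case
  proof (cases "n = 0")
    case True
    then show ?thesis using alternating_3[OF Suc.prems(1)] by (simp add: numeral_3_eq_3)
  next
    case False
    have "alternating (n + 2) (insert j (J - A)) = quad J (alternating n (insert j (J - A)))"
      if "j \<in> A" for j
      using Suc.prems that False by (intro Suc.IH) auto
    then show ?thesis by (simp add: quad_sum quad_theta)
  qed
qed simp

text \<open>Two more steps apply \<open>quad J\<close> to both sides, so lengths 1 and 2 suffice. At
  length 2 the mixed terms of \<open>A\<close> and \<open>J - A\<close> cancel against each
  other.\<close>

theorem total_eq_alternating:
  assumes "A \<subseteq> J" "n > 0"
  shows "total n = alternating n A + alternating n (J - A)"
  using assms(2)
proof (induction n rule: less_induct)
  case (less n)
  have fin: "finite A" "finite (J - A)" and AB: "A \<inter> (J - A) = {}" "A \<union> (J - A) = J" "J - (J - A) = A"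
    using assms finite_J finite_subset by auto
  consider "n = 1" | "n = 2" | m where "n = m + 2" "m > 0"
  proof -
    have "n = 1 \<or> n = 2 \<or> n = (n - 2) + 2 \<and> n - 2 > 0" using less.prems by linarith
    with that show thesis by blast
  qed
  then show ?case
  proof cases
    case 1
    then show ?thesis
      using lin_Un[OF fin AB(1)] AB(2) by (simp add: alternating_1[simplified])
  next
    case 2
    have "total 2 = quad J e"
      using finite_J by (simp add: numeral_2_eq_2 lin_lin)
    then show ?thesis
      using 2 assms(1) AB quad_Un[OF fin AB(1)]
      by (simp add: alternating_2 lin_lin_disjoint[OF AB(1)])
  next
    case 3
    have "total n = quad J (total m)"
      using 3 finite_J by (simp add: lin_lin)
    then show ?thesis
      using 3 less.IH[of m] assms(1)
      by (simp add: quad_add alternating_add2[of A] alternating_add2[of "J - A"]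
          del: add_2_eq_Suc' alternating.simps)
  qed
qed

end

section \<open>Signed deletion of run minima\<close>

lemma sum_fun_apply: "(\<Sum>i\<in>A. f i) x = (\<Sum>i\<in>A. f i x)"
  by (induction A rule: infinite_finite_induct) auto

definition block :: "(nat \<Rightarrow> 'b) \<Rightarrow> 'b \<Rightarrow> nat set \<Rightarrow> nat set" where
  "block c b D = {x \<in> D. c x = b}"

text \<open>The concrete \<open>\<theta>\<close>, acting on functions of the set of remaining
  positions; \<open>c\<close> names the run of a position. The exponent counts the inversions that
  the deleted letter, placed first, forms with the later ones. The value 0 on infinite sets lets
  anticommutation hold as an identity of functions.\<close>

definition remove_min :: "(nat \<Rightarrow> 'b) \<Rightarrow> 'b \<Rightarrow> (nat set \<Rightarrow> int) \<Rightarrow> nat set \<Rightarrow> int" where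
  "remove_min c b F D =
     (if finite D \<and> block c b D \<noteq> {}
      then (- 1) ^ card {x \<in> D. x < Min (block c b D)} * F (D - {Min (block c b D)}) else 0)"

definition delta_empty :: "nat set \<Rightarrow> int" where
  "delta_empty D = (if D = {} then 1 else 0)"

lemma Min_block:
  assumes "finite D" "block c b D \<noteq> {}"
  shows "Min (block c b D) \<in> D" "c (Min (block c b D)) = b"
proof -
  have "finite (block c b D)" using assms by (simp add: block_def)
  from Min_in[OF this assms(2)] show "Min (block c b D) \<in> D" "c (Min (block c b D)) = b"
    by (auto simp: block_def)
qed

text \<open>Source of the anticommutation: deleting the smaller element lowers the count below the
  larger one by one, while deleting the larger does not affect the smaller.\<close>

lemma sign_swap:
  fixes i j :: nat
  assumes "finite D" "i \<in> D" "i < j"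
  shows "(- 1) ^ card {x \<in> D. x < j} = - ((- 1 :: int) ^ card {x \<in> D - {i}. x < j})"
    and "(- 1) ^ card {x \<in> D. x < i} = ((- 1 :: int) ^ card {x \<in> D - {j}. x < i})"
proof -
  have "{x \<in> D. x < j} = insert i {x \<in> D - {i}. x < j}" using assms by auto
  then show "(- 1) ^ card {x \<in> D. x < j} = - ((- 1 :: int) ^ card {x \<in> D - {i}. x < j})"
    using assms by simp
  have "{x \<in> D. x < i} = {x \<in> D - {j}. x < i}" using assms by auto
  then show "(- 1) ^ card {x \<in> D. x < i} = ((- 1 :: int) ^ card {x \<in> D - {j}. x < i})" by simp
qed

text \<open>Deleting from one run keeps the minimum of the other, so both orders remove the same two
  elements, and exactly one of the two signs differs.\<close>

lemma remove_min_anticomm: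
  assumes "a \<noteq> b"
  shows "remove_min c a (remove_min c b F) D = - remove_min c b (remove_min c a F) D"
proof (cases "finite D \<and> block c a D \<noteq> {} \<and> block c b D \<noteq> {}")
  case True
  define i where "i = Min (block c a D)"
  define j where "j = Min (block c b D)"
  have i: "i \<in> D" "c i = a" and j: "j \<in> D" "c j = b"
    using True Min_block[of D c a] Min_block[of D c b] by (simp_all add: i_def j_def)
  have blk: "block c b (D - {i}) = block c b D" "block c a (D - {j}) = block c a D"
    using i j assms by (auto simp: block_def)
  have "i \<noteq> j" using i j assms by auto
  then consider "i < j" | "j < i" by linarith
  then show ?thesis
  proof cases
    case 1
    then show ?thesis
      using True i j sign_swap[of D i j]
      by (simp add: remove_min_def blk i_def[symmetric] j_def[symmetric] insert_commute)
         (simp add: Diff_insert2[symmetric] insert_commute)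
  next
    case 2
    then show ?thesis
      using True i j sign_swap[of D j i]
      by (simp add: remove_min_def blk i_def[symmetric] j_def[symmetric] insert_commute)
         (simp add: Diff_insert2[symmetric] insert_commute)
  qed
next
  case False
  \<comment> \<open>An exhausted run stays exhausted when \<open>D\<close> shrinks, so both sides
    vanish.\<close>
  have "block c b (D - {x}) \<subseteq> block c b D" "block c a (D - {x}) \<subseteq> block c a D" for x
    by (auto simp: block_def)
  then show ?thesis using False by (auto simp: remove_min_def)
qed

lemma anticommuting_remove_min: "finite J \<Longrightarrow> anticommuting J (remove_min c)"
proof (unfold_locales, goal_cases)
  case (2 j F G)
  then show ?case by (simp add: fun_eq_iff remove_min_def distrib_left)
next
  case (3 i j F)
  then show ?case using remove_min_anticomm by (intro ext) simp
qed

section \<open>Signed sums over lists with increasing runs\<close>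

text \<open>For distinct entries this is the usual sign by inversions, peeled off letter by letter
  to match \<open>remove_min\<close>.\<close>

primrec list_sign :: "nat list \<Rightarrow> int" where
  "list_sign [] = 1"
| "list_sign (x # v) = (- 1) ^ card {y \<in> set v. y < x} * list_sign v"

primrec alternates_from :: "bool \<Rightarrow> nat list \<Rightarrow> bool" where
  "alternates_from p [] = True"
| "alternates_from p (x # v) \<longleftrightarrow> even x = p \<and> alternates_from (\<not> p) v"

definition block_sorted :: "(nat \<Rightarrow> 'b) \<Rightarrow> nat set \<Rightarrow> nat list set" where
  "block_sorted c D =
     {v. distinct v \<and> set v = D \<and> sorted_wrt (\<lambda>x y. c x = c y \<longrightarrow> x < y) v}"

lemma finite_block_sorted: "finite D \<Longrightarrow> finite (block_sorted c D)"
  by (rule finite_subset[of _ "{v. set v \<subseteq> D \<and> length v = card D}"])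
     (auto simp: block_sorted_def distinct_card finite_lists_length_eq)

lemma block_sorted_empty: "block_sorted c {} = {[]}"
  by (auto simp: block_sorted_def)

text \<open>The first letter must be the least element of its own run, and putting it first
  restricts the rest no further.\<close>

lemma block_sorted_nonempty:
  assumes "finite D" "D \<noteq> {}"
  shows "block_sorted c D =
    (\<Union>b\<in>c ` D. (#) (Min (block c b D)) ` block_sorted c (D - {Min (block c b D)}))" (is "_ = ?R")
proof (intro set_eqI iffI)
  fix v assume v: "v \<in> block_sorted c D"
  with assms obtain x u where xu: "v = x # u" by (cases v) (auto simp: block_sorted_def)
  with v have x: "x \<in> D" "u \<in> block_sorted c (D - {x})" "\<And>y. y \<in> D \<Longrightarrow> c y = c x \<Longrightarrow> x \<le> y"
    by (auto simp: block_sorted_def)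
  then have "Min (block c (c x) D) = x"
    using assms by (intro Min_eqI) (auto simp: block_def)
  with x xu show "v \<in> ?R" by (intro UN_I[of "c x"]) auto
next
  fix v assume "v \<in> ?R"
  then obtain z u where z: "z \<in> D" and v: "v = Min (block c (c z) D) # u"
    and u: "u \<in> block_sorted c (D - {Min (block c (c z) D)})" by auto
  define x where "x = Min (block c (c z) D)"
  have ne: "block c (c z) D \<noteq> {}" and fin: "finite (block c (c z) D)"
    using z assms by (auto simp: block_def)
  have x: "x \<in> D" "c x = c z" using Min_block[OF assms(1) ne] by (auto simp: x_def)
  have "x < y" if "y \<in> D - {x}" "c x = c y" for y
  proof -
    have "x \<le> y" unfolding x_def using that x by (intro Min_le[OF fin]) (auto simp: block_def)
    with that show ?thesis by auto
  qed
  then show "v \<in> block_sorted c D"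
    using u v x unfolding block_sorted_def by (auto simp: x_def[symmetric])
qed

text \<open>The pieces of the union are disjoint because the first letter determines its
  run.\<close>

lemma sum_block_sorted:
  fixes h :: "nat list \<Rightarrow> int"
  assumes "finite D" "D \<noteq> {}"
  shows "(\<Sum>v\<in>block_sorted c D. h v) =
    (\<Sum>b\<in>c ` D. \<Sum>v\<in>block_sorted c (D - {Min (block c b D)}). h (Min (block c b D) # v))"
proof -
  have "c (Min (block c (c x) D)) = c x" if "x \<in> D" for x
    using that assms by (intro Min_block) (auto simp: block_def)
  then have inj: "c x = c y" if "x \<in> D" "y \<in> D" "Min (block c (c x) D) = Min (block c (c y) D)" for x y
    using that by metis
  show ?thesis
    unfolding block_sorted_nonempty[OF assms]
    by (subst sum.UNION_disjoint)
       (use assms inj in \<open>auto simp: finite_block_sorted sum.reindex\<close>)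
qed

lemma card_Diff_Min_block:
  assumes "finite D" "b \<in> c ` D"
  shows "card (D - {Min (block c b D)}) = card D - 1"
proof -
  have "block c b D \<noteq> {}" using assms(2) by (auto simp: block_def)
  then show ?thesis using Min_block(1)[of D c b] assms(1) by simp
qed

lemma sum_remove_min:
  assumes "finite D" "finite A"
  shows "(\<Sum>b\<in>A. remove_min c b (F b) D) = (\<Sum>b\<in>A \<inter> c ` D.
    (- 1) ^ card {x \<in> D. x < Min (block c b D)} * F b (D - {Min (block c b D)}))"
  by (rule sum.mono_neutral_cong_right)
     (use assms in \<open>auto simp: remove_min_def block_def\<close>)

lemma list_sign_Cons_block_sorted:
  assumes "finite D" "b \<in> c ` D" "v \<in> block_sorted c (D - {Min (block c b D)})"
  shows "list_sign (Min (block c b D) # v)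
    = (- 1) ^ card {x \<in> D. x < Min (block c b D)} * list_sign v"
proof -
  have "{y \<in> set v. y < Min (block c b D)} = {y \<in> D. y < Min (block c b D)}"
    using assms(3) by (auto simp: block_sorted_def)
  then show ?thesis by simp
qed

text \<open>\<open>J\<close> may contain runs absent from \<open>D\<close>: it stays fixed in the
  induction while \<open>D\<close> shrinks and runs are exhausted.\<close>

lemma sum_list_sign_eq_total:
  assumes "finite J" "finite D" "c ` D \<subseteq> J"
  shows "(\<Sum>v\<in>block_sorted c D. list_sign v)
    = anticommuting.total J (remove_min c) delta_empty (card D) D"
proof -
  interpret anticommuting J "remove_min c" delta_empty
    by (rule anticommuting_remove_min) fact
  show ?thesis
    using assms(2,3)
  proof (induction "card D" arbitrary: D)
    case 0
    have "delta_empty {} = 1" by (simp add: delta_empty_def)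
    with 0(1,2) show ?case by (simp add: block_sorted_empty)
  next
    case (Suc n)
    have D: "D \<noteq> {}" using Suc.hyps(2) by auto
    have "total (card D) D = (\<Sum>b\<in>J. remove_min c b (total n) D)"
      by (simp add: Suc.hyps(2)[symmetric] lin_def sum_fun_apply)
    also have "\<dots> = (\<Sum>b\<in>c ` D. (- 1) ^ card {x \<in> D. x < Min (block c b D)}
        * total n (D - {Min (block c b D)}))"
      using Suc.prems assms(1) by (simp add: sum_remove_min Int_absorb1)
    also have "\<dots> = (\<Sum>b\<in>c ` D. \<Sum>v\<in>block_sorted c (D - {Min (block c b D)}).
        list_sign (Min (block c b D) # v))"
    proof (rule sum.cong)
      fix b assume b: "b \<in> c ` D"
      have "n = card (D - {Min (block c b D)})"
        using card_Diff_Min_block[OF Suc.prems(1) b] Suc.hyps(2) by simp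
      with Suc.hyps(1)[OF this] Suc.prems
      have "(\<Sum>v\<in>block_sorted c (D - {Min (block c b D)}). list_sign v)
          = total n (D - {Min (block c b D)})" by auto
      then show "(- 1) ^ card {x \<in> D. x < Min (block c b D)} * total n (D - {Min (block c b D)})
        = (\<Sum>v\<in>block_sorted c (D - {Min (block c b D)}). list_sign (Min (block c b D) # v))"
        using b Suc.prems(1) by (simp add: list_sign_Cons_block_sorted sum_distrib_left[symmetric]
            del: list_sign.simps)
    qed simp
    finally show ?case using sum_block_sorted[OF Suc.prems(1) D, of list_sign c] by simp
  qed
qed

text \<open>\<open>A\<close> is prescribed only on runs still present, since the operators of
  exhausted runs vanish at \<open>D\<close>. The last hypothesis makes every run an interval, so
  that deleting its minimum flips the parity of the minimum.\<close>

lemma sum_alternating_list_sign_eq_alternating: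
  assumes "finite J" "finite D" "c ` D \<subseteq> J" "A \<subseteq> J"
    and "\<And>b. b \<in> c ` D \<Longrightarrow> b \<in> A \<longleftrightarrow> even (Min (block c b D)) = p"
    and "\<And>x y z. x \<in> D \<Longrightarrow> y \<in> D \<Longrightarrow> c x = c y \<Longrightarrow> x < z \<Longrightarrow> z < y \<Longrightarrow> z \<in> D \<and> c z = c x"
  shows "(\<Sum>v\<in>block_sorted c D. if alternates_from p v then list_sign v else 0)
    = anticommuting.alternating J (remove_min c) delta_empty (card D) A D"
proof -
  interpret anticommuting J "remove_min c" delta_empty
    by (rule anticommuting_remove_min) fact
  show ?thesis
    using assms(2-)
  proof (induction "card D" arbitrary: D A p)
    case 0
    have "delta_empty {} = 1" by (simp add: delta_empty_def)
    with 0(1,2) show ?case by (simp add: block_sorted_empty)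
  next
    case (Suc n)
    have D: "D \<noteq> {}" using Suc.hyps(2) by auto
    have finA: "finite A" by (rule finite_subset[OF Suc.prems(3) assms(1)])
    let ?h = "\<lambda>p v. if alternates_from p v then list_sign v else 0"
    have "alternating (card D) A D
        = (\<Sum>b\<in>A. remove_min c b (alternating n (insert b (J - A))) D)"
      by (simp add: Suc.hyps(2)[symmetric] sum_fun_apply)
    also have "\<dots> = (\<Sum>b\<in>A \<inter> c ` D. (- 1) ^ card {x \<in> D. x < Min (block c b D)}
        * alternating n (insert b (J - A)) (D - {Min (block c b D)}))"
      using Suc.prems(1) finA by (simp add: sum_remove_min)
    also have "\<dots> = (\<Sum>b\<in>c ` D. \<Sum>v\<in>block_sorted c (D - {Min (block c b D)}).
        ?h p (Min (block c b D) # v))"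
    proof (rule sum.mono_neutral_cong_left)
      \<comment> \<open>Runs outside \<open>A\<close> offer a first letter of the wrong
        parity.\<close>
      show "\<forall>b\<in>c ` D - A \<inter> c ` D. (\<Sum>v\<in>block_sorted c (D - {Min (block c b D)}).
        ?h p (Min (block c b D) # v)) = 0"
      proof (intro ballI sum.neutral)
        fix b v assume "b \<in> c ` D - A \<inter> c ` D"
        then show "?h p (Min (block c b D) # v) = 0" using Suc.prems(4)[of b] by auto
      qed
    next
      fix b assume b: "b \<in> A \<inter> c ` D"
      define m where "m = Min (block c b D)"
      have ne: "block c b D \<noteq> {}" using b by (auto simp: block_def)
      have m: "m \<in> D" "c m = b" "even m = p" "\<And>x. x \<in> D \<Longrightarrow> c x = b \<Longrightarrow> m \<le> x"
        using Min_block[OF Suc.prems(1) ne] Suc.prems(1,4) b Min_le[of "block c b D"]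
        by (auto simp: m_def block_def)
      have card: "n = card (D - {m})"
        using card_Diff_Min_block[OF Suc.prems(1), of b c] b Suc.hyps(2) by (simp add: m_def)
      have "(\<Sum>v\<in>block_sorted c (D - {m}). ?h (\<not> p) v)
          = alternating (card (D - {m})) (insert b (J - A)) (D - {m})"
      proof (rule Suc.hyps(1)[OF card])
        show "insert b (J - A) \<subseteq> J" using b Suc.prems(3) by auto
        show "b' \<in> insert b (J - A) \<longleftrightarrow> even (Min (block c b' (D - {m}))) = (\<not> p)"
          if b': "b' \<in> c ` (D - {m})" for b'
        proof (cases "b' = b")
          case True
          obtain y where y: "y \<in> D" "y \<noteq> m" "c y = b" using b' True by auto
          with m(4)[of y] have "m < y" by simp
          \<comment> \<open>The run is an interval, so its next minimum is \<open>Suc m\<close>,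
            which has the newly required parity: \<open>b\<close> stays admissible.\<close>
          then have "Suc m \<in> D \<and> c (Suc m) = b"
            using Suc.prems(5)[of m y "Suc m"] m y by (cases "Suc m = y") auto
          then have "Min (block c b (D - {m})) = Suc m"
            using Suc.prems(1) m(4) by (intro Min_eqI) (force simp: block_def Suc_le_eq less_le)+
          then show ?thesis using True m by simp
        next
          case False
          \<comment> \<open>The other runs keep their minima while the required parity flips, which
            complements \<open>A\<close>.\<close>
          then have "block c b' (D - {m}) = block c b' D" using m by (auto simp: block_def)
          moreover have "b' \<in> c ` D" "b' \<in> J" using b' Suc.prems(2) by auto
          ultimately show ?thesis using False Suc.prems(4)[of b'] by auto
        qed
        show "z \<in> D - {m} \<and> c z = c x"
          if "x \<in> D - {m}" "y \<in> D - {m}" "c x = c y" "x < z" "z < y" for x y z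
          using Suc.prems(5)[of x y z] that m by (metis DiffD1 Diff_iff leD m(4) singletonD)
      qed (use Suc.prems(1,2) in auto)
      then have "alternating n (insert b (J - A)) (D - {m}) = (\<Sum>v\<in>block_sorted c (D - {m}). ?h (\<not> p) v)"
        using card by simp
      moreover have "(\<Sum>v\<in>block_sorted c (D - {m}). ?h p (m # v))
        = (\<Sum>v\<in>block_sorted c (D - {m}). (- 1) ^ card {x \<in> D. x < m} * ?h (\<not> p) v)"
        using list_sign_Cons_block_sorted[OF Suc.prems(1), of b c] b m
        by (intro sum.cong) (auto simp: m_def simp del: list_sign.simps)
      ultimately show "(- 1) ^ card {x \<in> D. x < Min (block c b D)}
          * alternating n (insert b (J - A)) (D - {Min (block c b D)})
        = (\<Sum>v\<in>block_sorted c (D - {Min (block c b D)}). ?h p (Min (block c b D) # v))"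
        by (simp only: m_def[symmetric] sum_distrib_left)
    qed (use Suc.prems(1) in auto)
    finally show ?case using sum_block_sorted[OF Suc.prems(1) D, of "?h p" c] by simp
  qed
qed

text \<open>With \<open>A\<close> the runs of even minimum, \<open>A\<close> and its complement
  count the lists alternating from an even and from an odd entry. Together they already give the
  full signed sum.\<close>

lemma sum_non_alternating_list_sign:
  assumes "finite D" "D \<noteq> {}"
    and "\<And>x y z. x \<in> D \<Longrightarrow> y \<in> D \<Longrightarrow> c x = c y \<Longrightarrow> x < z \<Longrightarrow> z < y \<Longrightarrow> z \<in> D \<and> c z = c x"
  shows "(\<Sum>v | v \<in> block_sorted c D \<and> \<not> (\<exists>p. alternates_from p v). list_sign v) = 0"
proof -
  let ?J = "c ` D"
  define A where "A = {b \<in> ?J. even (Min (block c b D))}"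
  interpret anticommuting ?J "remove_min c" delta_empty
    by (rule anticommuting_remove_min) (use assms(1) in simp)
  have fin: "finite (block_sorted c D)" by (rule finite_block_sorted) fact
  let ?h = "\<lambda>p v. if alternates_from p v then list_sign v else 0"
  have "(\<Sum>v\<in>block_sorted c D. list_sign v) = total (card D) D"
    using assms(1) by (intro sum_list_sign_eq_total) auto
  also have "\<dots> = alternating (card D) A D + alternating (card D) (?J - A) D"
    using assms(1,2) by (subst total_eq_alternating[of A]) (auto simp: A_def card_gt_0_iff)
  also have "alternating (card D) A D = (\<Sum>v\<in>block_sorted c D. ?h True v)"
    by (rule sum_alternating_list_sign_eq_alternating[symmetric]) (use assms(1) in \<open>auto simp: A_def dest: assms(3)\<close>)
  also have "alternating (card D) (?J - A) D = (\<Sum>v\<in>block_sorted c D. ?h False v)"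
    by (rule sum_alternating_list_sign_eq_alternating[symmetric]) (use assms(1) in \<open>auto simp: A_def dest: assms(3)\<close>)
  finally have "(\<Sum>v\<in>block_sorted c D. list_sign v - (?h True v + ?h False v)) = 0"
    by (simp add: sum_subtractf sum.distrib)
  also have "(\<Sum>v\<in>block_sorted c D. list_sign v - (?h True v + ?h False v))
      = (\<Sum>v | v \<in> block_sorted c D \<and> \<not> (\<exists>p. alternates_from p v). list_sign v)"
  proof (rule sum.mono_neutral_cong_right[OF fin])
    \<comment> \<open>The empty list alternates from both parities and would be subtracted twice; it
      is excluded as \<open>D\<close> is nonempty.\<close>
    have excl: "\<not> (alternates_from True v \<and> alternates_from False v)" if "v \<in> block_sorted c D" for v
      using that assms(2) by (cases v) (auto simp: block_sorted_def)
    show "\<forall>v\<in>block_sorted c D - {v \<in> block_sorted c D. \<not> (\<exists>p. alternates_from p v)}.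
        list_sign v - (?h True v + ?h False v) = 0"
      using excl by (auto simp: ex_bool_eq)
  qed (auto simp: ex_bool_eq)
  finally show ?thesis .
qed

section \<open>Permutations and their inverse words\<close>

text \<open>Inversions at index 0 are counted by the entries below the head; all others come from
  the tail, shifted by one.\<close>

lemma list_sign_eq_inversions:
  "distinct v \<Longrightarrow> list_sign v = (- 1) ^ card {(a, b). a < b \<and> b < length v \<and> v ! b < v ! a}"
proof (induction v)
  case (Cons x v)
  let ?I = "{(a, b). a < b \<and> b < length v \<and> v ! b < v ! a}"
  let ?H = "{b. b < length v \<and> v ! b < x}"
  have fin: "finite ?I"
    by (rule finite_subset[of _ "{..<length v} \<times> {..<length v}"]) auto
  have "bij_betw (nth v) ?H {y \<in> set v. y < x}"
    using Cons.prems by (auto simp: bij_betw_def inj_on_def nth_eq_iff_index_eq in_set_conv_nth)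
  then have "card {y \<in> set v. y < x} = card ?H" by (rule bij_betw_same_card[symmetric])
  moreover have "{(a, b). a < b \<and> b < length (x # v) \<and> (x # v) ! b < (x # v) ! a}
      = (\<lambda>b. (0, Suc b)) ` ?H \<union> map_prod Suc Suc ` ?I" (is "?L = ?R")
  proof (intro set_eqI)
    fix q :: "nat \<times> nat"
    obtain a b where "q = (a, b)" by fastforce
    then show "q \<in> ?L \<longleftrightarrow> q \<in> ?R"
      by (cases a; cases b) (auto simp: image_iff)
  qed
  moreover have "card ((\<lambda>b. (0, Suc b)) ` ?H \<union> map_prod Suc Suc ` ?I) = card ?H + card ?I"
    using fin by (subst card_Un_disjoint) (auto simp: card_image inj_on_def)
  ultimately show ?case using Cons by (simp add: power_add)
qed simp

lemma alternates_from_iff_nth: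
  "alternates_from e v \<longleftrightarrow> (\<forall>a<length v. even (v ! a) = (e = even a))"
proof (induction v arbitrary: e)
  case (Cons x v)
  have "(\<forall>a<length (x # v). even ((x # v) ! a) = (e = even a)) \<longleftrightarrow>
    even x = e \<and> (\<forall>a<length v. even (v ! a) = ((\<not> e) = even a))"
    by (auto simp: All_less_Suc2)
  then show ?case using Cons.IH by simp
qed simp

text \<open>Lists start at index 0, so the entry with index \<open>a\<close> is the position of the value \<open>a + 1\<close>.\<close>

definition inverse_word :: "nat \<Rightarrow> (nat \<Rightarrow> nat) \<Rightarrow> nat list" where
  "inverse_word n p = map (inv p) [1..<Suc n]"

lemma length_inverse_word [simp]: "length (inverse_word n p) = n"
  by (simp add: inverse_word_def)

lemma nth_inverse_word: "a < n \<Longrightarrow> inverse_word n p ! a = inv p (Suc a)"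
  by (simp add: inverse_word_def del: upt_Suc)

lemma set_inverse_word: "p permutes {1..n} \<Longrightarrow> set (inverse_word n p) = {1..n}"
  using permutes_image[OF permutes_inv, of p "{1..n}"]
  by (simp add: inverse_word_def atLeastLessThanSuc_atLeastAtMost del: upt_Suc)

lemma distinct_inverse_word: "p permutes {1..n} \<Longrightarrow> distinct (inverse_word n p)"
  using permutes_inj[OF permutes_inv, of p "{1..n}"]
  by (simp add: inverse_word_def distinct_map inj_on_def inj_def del: upt_Suc)

lemma bij_betw_inverse_word:
  "bij_betw (inverse_word n) {p. p permutes {1..n}} {v. distinct v \<and> set v = {1..n}}"
proof (rule bij_betw_imageI)
  show "inj_on (inverse_word n) {p. p permutes {1..n}}"
  proof (rule inj_onI, clarify)
    fix p q assume p: "p permutes {1..n}" and q: "q permutes {1..n}"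
      and eq: "inverse_word n p = inverse_word n q"
    have "inv p i = inv q i" for i
    proof (cases "i \<in> {1..n}")
      case True
      then have "inverse_word n p ! (i - 1) = inverse_word n q ! (i - 1)" "i - 1 < n" "Suc (i - 1) = i"
        using eq by auto
      then show ?thesis by (metis nth_inverse_word)
    next
      case False
      then show ?thesis
        using permutes_not_in[OF permutes_inv[OF p]] permutes_not_in[OF permutes_inv[OF q]] by simp
    qed
    then have "inv p = inv q" by blast
    then show "p = q" using permutes_inv_inv[OF p] permutes_inv_inv[OF q] by metis
  qed
  show "inverse_word n ` {p. p permutes {1..n}} = {v. distinct v \<and> set v = {1..n}}"
  proof (intro subset_antisym subsetI)
    fix v assume "v \<in> {v. distinct v \<and> set v = {1..n}}"
    then have v: "distinct v" "set v = {1..n}" "length v = n"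
      using distinct_card[of v] by auto
    \<comment> \<open>\<open>v\<close> is the one-line notation of \<open>q\<close>, so its preimage
      is \<open>inv q\<close>.\<close>
    define q where "q i = (if i \<in> {1..n} then v ! (i - 1) else i)" for i
    have "bij_betw q {1..n} {1..n}"
    proof (rule bij_betw_imageI)
      show "inj_on q {1..n}"
        using v by (auto simp: inj_on_def q_def nth_eq_iff_index_eq)
      have "q ` {1..n} \<subseteq> {1..n}" using v nth_mem[of _ v] by (auto simp: q_def)
      moreover have "x \<in> q ` {1..n}" if x: "x \<in> {1..n}" for x
      proof -
        from x v obtain a where "a < n" "v ! a = x" by (metis in_set_conv_nth)
        then have "q (Suc a) = x" "Suc a \<in> {1..n}" by (auto simp: q_def)
        then show ?thesis by blast
      qed
      ultimately show "q ` {1..n} = {1..n}" by blast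
    qed
    then have q: "q permutes {1..n}" by (rule bij_imp_permutes) (auto simp: q_def)
    have "inverse_word n (inv q) = v"
      using v permutes_inv_inv[OF q]
      by (intro nth_equalityI) (auto simp: nth_inverse_word q_def)
    then show "v \<in> inverse_word n ` {p. p permutes {1..n}}"
      using permutes_inv[OF q] by blast
  qed (auto simp: set_inverse_word distinct_inverse_word simp del: atLeastAtMost_iff)
qed

text \<open>A permutation and its inverse have equally many inversions: \<open>(i, j)\<close>
  corresponds to the values \<open>(p j, p i)\<close>, lowered by one to become list
  indices.\<close>

lemma list_sign_inverse_word:
  assumes "p permutes {1..n}"
  shows "list_sign (inverse_word n p) = (- 1) ^ card (inversions n p)"
proof -
  let ?L = "{(a, b). a < b \<and> b < n \<and> inverse_word n p ! b < inverse_word n p ! a}"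
  have inv: "inv p (p i) = i" "p (inv p i) = i" for i
    using permutes_inverses[OF assms] by auto
  have mem: "1 \<le> p i \<and> p i \<le> n \<longleftrightarrow> 1 \<le> i \<and> i \<le> n" for i
    using permutes_in_image[OF assms, of i] by simp
  have "bij_betw (\<lambda>(i, j). (p j - 1, p i - 1)) (inversions n p) ?L"
  proof (rule bij_betw_byWitness[where f' = "\<lambda>(a, b). (inv p (Suc b), inv p (Suc a))"])
    show "(\<lambda>(i, j). (p j - 1, p i - 1)) ` inversions n p \<subseteq> ?L"
    proof (rule image_subsetI)
      fix q assume "q \<in> inversions n p"
      then obtain i j where q: "q = (i, j)" and ij: "1 \<le> i" "i < j" "j \<le> n" "p j < p i"
        by (auto simp: inversions_def)
      with mem[of i] mem[of j] have "1 \<le> p j" "p i \<le> n" by auto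
      moreover from this ij have "p j - 1 < p i - 1" "p i - 1 < n" by linarith+
      ultimately show "(case q of (i, j) \<Rightarrow> (p j - 1, p i - 1)) \<in> ?L"
        using ij by (simp add: q nth_inverse_word inv)
    qed
    show "(\<lambda>(a, b). (inv p (Suc b), inv p (Suc a))) ` ?L \<subseteq> inversions n p"
    proof (rule image_subsetI)
      fix q assume "q \<in> ?L"
      then obtain a b where q: "q = (a, b)" "a < b" "b < n"
        "inverse_word n p ! b < inverse_word n p ! a" by blast
      then show "(case q of (a, b) \<Rightarrow> (inv p (Suc b), inv p (Suc a))) \<in> inversions n p"
        using mem[of "inv p (Suc a)"] mem[of "inv p (Suc b)"]
        by (simp add: inversions_def nth_inverse_word inv)
    qed
    show "\<forall>q\<in>inversions n p. (case case q of (i, j) \<Rightarrow> (p j - 1, p i - 1) of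
        (a, b) \<Rightarrow> (inv p (Suc b), inv p (Suc a))) = q"
    proof
      fix q assume "q \<in> inversions n p"
      then obtain i j where q: "q = (i, j)" "1 \<le> i" "i < j" "j \<le> n"
        by (auto simp: inversions_def)
      then have "1 \<le> p i" "1 \<le> p j" using mem[of i] mem[of j] by auto
      then show "(case case q of (i, j) \<Rightarrow> (p j - 1, p i - 1) of
        (a, b) \<Rightarrow> (inv p (Suc b), inv p (Suc a))) = q"
        by (simp add: q inv)
    qed
  qed (auto simp: inv)
  then have "card (inversions n p) = card ?L" by (rule bij_betw_same_card)
  then show ?thesis
    using list_sign_eq_inversions[OF distinct_inverse_word[OF assms]] by simp
qed

text \<open>This form treats position and value symmetrically, so it passes to the inverse.\<close>

lemma parity_alternating_iff:
  "parity_alternating n p \<longleftrightarrow> (\<exists>e. \<forall>i\<in>{1..n}. even (p i) = (even i = e))"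
proof
  assume alt: "parity_alternating n p"
  have *: "even (p i) = (even i = odd (p 1))" if "1 \<le> i" "i \<le> n" for i
    using that
  proof (induction i rule: dec_induct)
    case (step i)
    have "even (p i) \<noteq> even (p (i + 1))"
      using alt[unfolded parity_alternating_def, rule_format, of i] step.hyps step.prems by simp
    moreover have "even (p i) = (even i = odd (p 1))"
      using step.IH step.prems by simp
    ultimately show ?case by auto
  qed simp
  show "\<exists>e. \<forall>i\<in>{1..n}. even (p i) = (even i = e)"
    by (intro exI[of _ "odd (p 1)"] ballI *) simp_all
next
  assume "\<exists>e. \<forall>i\<in>{1..n}. even (p i) = (even i = e)"
  then obtain e where e: "\<And>i. i \<in> {1..n} \<Longrightarrow> even (p i) = (even i = e)" by blast
  show "parity_alternating n p"
    unfolding parity_alternating_def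
  proof
    fix i assume "i \<in> {1..<n}"
    with e[of i] e[of "i + 1"] show "even (p i) \<noteq> even (p (i + 1))" by auto
  qed
qed

lemma alternates_from_inverse_word:
  assumes "p permutes {1..n}"
  shows "(\<exists>e. alternates_from e (inverse_word n p)) \<longleftrightarrow> parity_alternating n p"
proof -
  have inv: "inv p (p i) = i" "p (inv p i) = i" for i
    using permutes_inverses[OF assms] by auto
  \<comment> \<open>The negation of \<open>e\<close> accounts for index \<open>a\<close> holding the
    position of the value \<open>a + 1\<close>.\<close>
  have eq: "alternates_from (\<not> e) (inverse_word n p) \<longleftrightarrow> (\<forall>i\<in>{1..n}. even (p i) = (even i = e))" for e
  proof -
    have "alternates_from (\<not> e) (inverse_word n p) \<longleftrightarrow> (\<forall>a<n. even (inv p (Suc a)) = (even (Suc a) = e))"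
      by (auto simp: alternates_from_iff_nth nth_inverse_word)
    also have "\<dots> \<longleftrightarrow> (\<forall>j\<in>{1..n}. even (inv p j) = (even j = e))"
      unfolding image_Suc_lessThan[symmetric] by auto
    also have "\<dots> \<longleftrightarrow> (\<forall>j\<in>p ` {1..n}. even (inv p j) = (even j = e))"
      by (simp only: permutes_image[OF assms])
    also have "\<dots> \<longleftrightarrow> (\<forall>i\<in>{1..n}. even (p i) = (even i = e))"
      unfolding ball_simps(9) inv by (intro ball_cong refl) auto
    finally show ?thesis .
  qed
  show ?thesis using eq[of True] eq[of False] by (auto simp: parity_alternating_iff ex_bool_eq)
qed

section \<open>Runs cut out by forced ascents\<close>

text \<open>Since \<open>i \<in> S\<close> forces an ascent between \<open>i\<close> and \<open>i + 1\<close>, the runs are the fibres of this map.\<close>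

definition run_index :: "nat set \<Rightarrow> nat \<Rightarrow> nat" where
  "run_index S i = card {x. x < i \<and> x \<notin> S}"

lemma run_index_Suc: "run_index S (Suc i) = (if i \<in> S then run_index S i else Suc (run_index S i))"
proof -
  have "{x. x < Suc i \<and> x \<notin> S} = (if i \<in> S then {} else {i}) \<union> {x. x < i \<and> x \<notin> S}"
    by (auto simp: less_Suc_eq)
  then show ?thesis by (simp add: run_index_def)
qed

lemma run_index_mono: "i \<le> j \<Longrightarrow> run_index S i \<le> run_index S j"
  unfolding run_index_def by (intro card_mono) auto

lemma run_index_eqD:
  assumes "run_index S i = run_index S j" "i \<le> k" "k < j"
  shows "k \<in> S"
proof (rule ccontr)
  assume "k \<notin> S"
  then have "run_index S (Suc k) = Suc (run_index S k)" by (simp add: run_index_Suc)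
  with run_index_mono[OF assms(2), of S] run_index_mono[of "Suc k" j S] assms(1,3)
  show False by linarith
qed

text \<open>Both sides say that \<open>p\<close> increases along each run: neighbouring positions of
  a run give the forced ascents, and chaining these gives back the whole run.\<close>

lemma inverse_word_block_sorted_iff:
  assumes p: "p permutes {1..n}" and S: "S \<subseteq> {1..<n}"
  shows "inverse_word n p \<in> block_sorted (run_index S) {1..n} \<longleftrightarrow> S \<subseteq> ascents n p"
proof -
  let ?v = "inverse_word n p"
  have inv: "inv p (p i) = i" "p (inv p i) = i" for i
    using permutes_inverses[OF p] by auto
  have mem: "p i \<in> {1..n} \<longleftrightarrow> i \<in> {1..n}" for i
    by (rule permutes_in_image[OF p])
  have "?v \<in> block_sorted (run_index S) {1..n} \<longleftrightarrow>
    (\<forall>a b. a < b \<and> b < n \<longrightarrow> run_index S (?v ! a) = run_index S (?v ! b) \<longrightarrow> ?v ! a < ?v ! b)"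
    using set_inverse_word[OF p] distinct_inverse_word[OF p]
    by (auto simp: block_sorted_def sorted_wrt_iff_nth_less)
  also have "\<dots> \<longleftrightarrow> S \<subseteq> ascents n p"
  proof
    assume *: "\<forall>a b. a < b \<and> b < n \<longrightarrow> run_index S (?v ! a) = run_index S (?v ! b) \<longrightarrow> ?v ! a < ?v ! b"
    show "S \<subseteq> ascents n p"
    proof
      fix i assume i: "i \<in> S"
      with S have in1: "i \<in> {1..n}" "i + 1 \<in> {1..n}" "i \<in> {1..<n}" by auto
      have "p i < p (i + 1)"
      proof (rule ccontr)
        assume "\<not> p i < p (i + 1)"
        moreover have "p i \<noteq> p (i + 1)" using inv by (metis add_eq_self_zero one_neq_zero)
        \<comment> \<open>At a descent, \<open>i + 1\<close> would stand before \<open>i\<close> in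
          the inverse word, although \<open>i \<in> S\<close> puts both in one run.\<close>
        ultimately have "p (i + 1) - 1 < p i - 1" "p i - 1 < n" "Suc (p i - 1) = p i"
          "Suc (p (i + 1) - 1) = p (i + 1)"
          using mem[of i] mem[of "i + 1"] in1 by auto
        moreover from this have "?v ! (p (i + 1) - 1) = i + 1" "?v ! (p i - 1) = i"
          by (auto simp: nth_inverse_word inv(1))
        ultimately have "run_index S (i + 1) = run_index S i \<longrightarrow> i + 1 < i"
          using *[rule_format, of "p (i + 1) - 1" "p i - 1"] by metis
        then show False using i by (simp add: run_index_Suc)
      qed
      with in1 show "i \<in> ascents n p" by (simp add: ascents_def)
    qed
  next
    assume asc: "S \<subseteq> ascents n p"
    have run: "p i < p j" if "run_index S i = run_index S j" "i < j" for i j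
      using that(2,1)
    proof (induction rule: strict_inc_induct)
      case (base k)
      have "k \<in> S" using run_index_eqD[of S k j k] base by simp
      with asc base show ?case by (auto simp: ascents_def)
    next
      case (step k)
      have "k \<in> S" using run_index_eqD[of S k j k] step by simp
      moreover from this have "p k < p (Suc k)" using asc by (auto simp: ascents_def)
      ultimately show ?case using step by (auto simp: run_index_Suc)
    qed
    show "\<forall>a b. a < b \<and> b < n \<longrightarrow> run_index S (?v ! a) = run_index S (?v ! b) \<longrightarrow> ?v ! a < ?v ! b"
    proof (intro allI impI, rule ccontr)
      fix a b assume ab: "a < b \<and> b < n" and "run_index S (?v ! a) = run_index S (?v ! b)"
        and "\<not> ?v ! a < ?v ! b"
      moreover have "?v ! a \<noteq> ?v ! b"
        using ab distinct_inverse_word[OF p] by (simp add: nth_eq_iff_index_eq)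
      ultimately have "p (?v ! b) < p (?v ! a)" by (intro run) auto
      with ab show False by (simp add: nth_inverse_word inv)
    qed
  qed
  finally show ?thesis .
qed

section \<open>From forced ascents to exact ascent sets and the count\<close>

text \<open>Inclusion-exclusion as an induction from large \<open>S\<close> down: the sum over
  supersets is the exact term plus terms of strictly larger sets, which vanish already.\<close>

lemma sum_superset_zero_imp:
  fixes g :: "'a \<Rightarrow> 'b::ab_group_add"
  assumes "finite P" "finite N" "\<And>x. x \<in> P \<Longrightarrow> f x \<subseteq> N"
    and zero: "\<And>S. S \<subseteq> N \<Longrightarrow> (\<Sum>x | x \<in> P \<and> S \<subseteq> f x. g x) = 0"
    and "S \<subseteq> N"
  shows "(\<Sum>x | x \<in> P \<and> f x = S. g x) = 0"
  using \<open>S \<subseteq> N\<close>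
proof (induction "card (N - S)" arbitrary: S rule: less_induct)
  case less
  have fin: "finite {U. U \<subseteq> N \<and> S \<subset> U}" 
    by (rule finite_subset[of _ "Pow N"]) (use assms(2) in auto)
  have "0 = (\<Sum>x | x \<in> P \<and> S \<subseteq> f x. g x)" using zero less.prems by simp
  also have "{x. x \<in> P \<and> S \<subseteq> f x}
      = {x. x \<in> P \<and> f x = S} \<union> (\<Union>U\<in>{U. U \<subseteq> N \<and> S \<subset> U}. {x. x \<in> P \<and> f x = U})"
    using assms(3) by auto
  also have "sum g \<dots> = (\<Sum>x | x \<in> P \<and> f x = S. g x)
      + (\<Sum>x\<in>(\<Union>U\<in>{U. U \<subseteq> N \<and> S \<subset> U}. {x. x \<in> P \<and> f x = U}). g x)"
    using assms(1) fin by (intro sum.union_disjoint) auto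
  also have "(\<Sum>x\<in>(\<Union>U\<in>{U. U \<subseteq> N \<and> S \<subset> U}. {x. x \<in> P \<and> f x = U}). g x)
      = (\<Sum>U | U \<subseteq> N \<and> S \<subset> U. \<Sum>x | x \<in> P \<and> f x = U. g x)"
    using assms(1) fin by (intro sum.UNION_disjoint) auto
  also have "\<dots> = 0"
  proof (rule sum.neutral, rule ballI)
    fix U assume "U \<in> {U. U \<subseteq> N \<and> S \<subset> U}"
    then have U: "U \<subseteq> N" "S \<subset> U" by auto
    then have "card (N - U) < card (N - S)"
      using assms(2) by (intro psubset_card_mono) auto
    then show "(\<Sum>x | x \<in> P \<and> f x = U. g x) = 0" using less.hyps U(1) by blast
  qed
  finally show ?case by simp
qed

text \<open>The inverse word carries these permutations, with their signs, onto the non-alternating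
  lists whose runs increase.\<close>

lemma sum_sign_non_alternating_superset:
  assumes "n > 0" "S \<subseteq> {1..<n}"
  shows "(\<Sum>p | p \<in> {p. p permutes {1..n} \<and> \<not> parity_alternating n p} \<and> S \<subseteq> ascents n p.
    (- 1 :: int) ^ card (inversions n p)) = 0"
proof -
  let ?P = "{p. p \<in> {p. p permutes {1..n} \<and> \<not> parity_alternating n p} \<and> S \<subseteq> ascents n p}"
  let ?V = "{v. v \<in> block_sorted (run_index S) {1..n} \<and> \<not> (\<exists>e. alternates_from e v)}"
  have bij: "bij_betw (inverse_word n) ?P ?V"
    unfolding bij_betw_def
  proof
    show "inj_on (inverse_word n) ?P"
      using bij_betw_inverse_word[of n] by (auto simp: bij_betw_def intro: inj_on_subset)
    have "v \<in> inverse_word n ` ?P" if v: "v \<in> ?V" for v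
    proof -
      have "v \<in> inverse_word n ` {p. p permutes {1..n}}"
        using v bij_betw_inverse_word[of n] by (simp add: bij_betw_def block_sorted_def)
      then obtain p where p: "p permutes {1..n}" "v = inverse_word n p" by auto
      then have "p \<in> ?P"
        using v inverse_word_block_sorted_iff[OF p(1) assms(2)] alternates_from_inverse_word[OF p(1)]
        by auto
      with p show ?thesis by blast
    qed
    moreover have "inverse_word n p \<in> ?V" if "p \<in> ?P" for p
      using that inverse_word_block_sorted_iff[OF _ assms(2)] alternates_from_inverse_word[of p n]
      by auto
    ultimately show "inverse_word n ` ?P = ?V" by blast
  qed
  have "(\<Sum>p\<in>?P. (- 1 :: int) ^ card (inversions n p)) = (\<Sum>p\<in>?P. list_sign (inverse_word n p))"
    by (rule sum.cong) (auto simp: list_sign_inverse_word)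
  also have "\<dots> = (\<Sum>v\<in>?V. list_sign v)"
    by (rule sum.reindex_bij_betw[OF bij])
  also have "\<dots> = 0"
  proof (rule sum_non_alternating_list_sign)
    fix x y z assume "x \<in> {1..n}" "y \<in> {1..n}" "run_index S x = run_index S y" "x < z" "z < y"
    \<comment> \<open>Fibres of the monotone \<open>run_index S\<close> are intervals.\<close>
    then show "z \<in> {1..n} \<and> run_index S z = run_index S x"
      using run_index_mono[of x z S] run_index_mono[of z y S] by auto
  qed (use assms(1) in auto)
  finally show ?thesis .
qed

theorem theorem3:
  fixes n k :: nat
  assumes "n > 0" and "k \<le> n - 1"
  shows "card {p \<in> non_parity_alternating_perms n k. even_permutation n p} =
         card {p \<in> non_parity_alternating_perms n k. odd_permutation n p}"
proof -
  let ?P = "{p. p permutes {1..n} \<and> \<not> parity_alternating n p}"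
  let ?N = "non_parity_alternating_perms n k"
  let ?s = "\<lambda>p. (- 1 :: int) ^ card (inversions n p)"
  have finP: "finite ?P"
    by (rule finite_subset[OF _ finite_permutations[of "{1..n}"]]) auto
  have asc: "ascents n p \<subseteq> {1..<n}" for p by (auto simp: ascents_def)
  have zero: "(\<Sum>p | p \<in> ?P \<and> ascents n p = S. ?s p) = 0" if "S \<subseteq> {1..<n}" for S
    by (rule sum_superset_zero_imp[where N = "{1..<n}"])
       (use finP asc that sum_sign_non_alternating_superset[OF assms(1)] in auto)
  \<comment> \<open>Having \<open>k\<close> ascents splits into the possible ascent sets of size
    \<open>k\<close>, each with signed sum 0.\<close>
  have N: "?N = (\<Union>S\<in>{S. S \<subseteq> {1..<n} \<and> card S = k}. {p. p \<in> ?P \<and> ascents n p = S})"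
    using asc by (auto simp: non_parity_alternating_perms_def)
  have "(\<Sum>p\<in>?N. ?s p) = (\<Sum>S | S \<subseteq> {1..<n} \<and> card S = k. \<Sum>p | p \<in> ?P \<and> ascents n p = S. ?s p)"
    unfolding N
  proof (rule sum.UNION_disjoint)
    show "\<forall>S\<in>{S. S \<subseteq> {1..<n} \<and> card S = k}. finite {p. p \<in> ?P \<and> ascents n p = S}"
      using finP by (metis (no_types, lifting) finite_subset mem_Collect_eq subsetI)
  qed auto
  also have "\<dots> = 0" using zero by (intro sum.neutral) blast
  finally have sum0: "(\<Sum>p\<in>?N. ?s p) = 0" .
  have finN: "finite ?N"
    by (rule finite_subset[OF _ finP]) (auto simp: non_parity_alternating_perms_def)
  let ?E = "{p \<in> ?N. even_permutation n p}" and ?O = "{p \<in> ?N. odd_permutation n p}"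
  have "?N = ?E \<union> ?O" "?E \<inter> ?O = {}"
    by (auto simp: even_permutation_def odd_permutation_def)
  \<comment> \<open>The signed sum is the number of even minus the number of odd
    permutations.\<close>
  then have "(\<Sum>p\<in>?N. ?s p) = (\<Sum>p\<in>?E. ?s p) + (\<Sum>p\<in>?O. ?s p)"
    using finN by (metis (no_types, lifting) finite_Un sum.union_disjoint)
  also have "(\<Sum>p\<in>?E. ?s p) = int (card ?E)"
    by (simp add: even_permutation_def)
  also have "(\<Sum>p\<in>?O. ?s p) = - int (card ?O)"
    by (simp add: odd_permutation_def)
  finally show ?thesis using sum0 by simp
qed

end
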